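(* Let $\alpha\in\mathbb{R}$, $h>0$, let $Y_1,\dots,Y_s$ be the stages and $y_1=y_0+h\sum_{i=1}^s b_if(Y_i)$ the numerical solution produced by one step, with stepsize $h$, of the Runge-Kutta method with Butcher matrix $A(\alpha)$ and weights $b_i$ applied to $\dot y=f(y)$, $y(0)=y_0$. Let $\gamma_j$, $\phi_{ij}$ and the polynomials $\sigma_1,\sigma_2$ be as defined in the context, and set $$\rho_j(\sigma_1)=\int_0^1P_j(c)\nabla C(\sigma_1(ch))\,dc,\quad j=0,\dots,s-1,\qquad \bar\rho(\sigma_2)=\int_0^1\nabla C(\sigma_2(c))\,dc .$$ Then $C(y_1)=C(y_0)$, provided that $$\alpha=\frac{\sum_{j=0}^{s-1}\rho_j(\sigma_1)^\top\gamma_j}{\left(\rho_0(\sigma_1)-\bar\rho(\sigma_2)\right)^\top\left(\phi_{20}\gamma_0-\phi_{10}\gamma_1\right)+\sum_{j=1}^{s-1}\rho_j(\sigma_1)^\top\left(\phi_{2j}\gamma_0-\phi_{1j}\gamma_1\right)} .$$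
   Context: The problem is $\dot y=f(y)$, $y(0)=y_0\in U\subseteq\mathbb{R}^m$ ($U$ open), with $f:U\to\mathbb{R}^m$ suitably regular (e.g. analytic), and $C:U\to\mathbb{R}$ is a suitably regular (e.g. analytic) constant of motion: $\nabla C(y)^\top f(y)=0$ for all $y\in U$. All points at which $f$ and $\nabla C$ are evaluated are assumed to lie in $U$. Fix an integer $s\ge2$. $\{P_j\}_{j\ge0}$ are the Legendre polynomials orthonormal on $[0,1]$ ($\deg P_j=j$, positive leading coefficient, $\int_0^1P_iP_j\,dx=\delta_{ij}$). $c_1<\dots<c_s$ are the zeros of $P_s$ and $b_i=\int_0^1\prod_{j\ne i}\frac{x-c_j}{c_i-c_j}dx$ (Gauss-Legendre nodes and weights on $[0,1]$). $\mathcal{P}_s\in\mathbb{R}^{s\times s}$ has $(i,j)$ entry $P_{j-1}(c_i)$, and $\Omega=\mathrm{diag}(b_1,\dots,b_s)$. With $\xi_i=\frac{1}{2\sqrt{|4i^2-1|}}$, $X_s\in\mathbb{R}^{s\times s}$ is the tridiagonal matrix with $(1,1)$ entry $\xi_0$, all other diagonal entries $0$, $(i+1,i)$ entry $\xi_i$ and $(i,i+1)$ entry $-\xi_i$ for $i=1,\dots,s-1$. With $e_i\in\mathbb{R}^s$ the $i$th unit vector, $W_s=e_2e_1^\top-e_1e_2^\top$, $X_s(\alpha)=X_s-\alpha W_s$ and $A(\alpha)=\mathcal{P}_sX_s(\alpha)\mathcal{P}_s^\top\Omega$. The stages satisfy $Y_i=y_0+h\sum_{j=1}^sA(\alpha)_{ij}f(Y_j)$,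 $i=1,\dots,s$. Define $\gamma_j=\sum_{i=1}^sb_iP_j(c_i)f(Y_i)$, $j=0,\dots,s-1$, and $(\phi_{i0},\dots,\phi_{i,s-1})^\top=X_s^{-1}e_i$, $i=1,2$. Define $$\sigma_1(ch)=y_0+h\sum_{j=0}^{s-1}\int_0^cP_j(x)dx\,\left[\gamma_j-\alpha(\phi_{2j}\gamma_0-\phi_{1j}\gamma_1)\right],\quad c\in[0,1],$$ $$\sigma_2(t)=y_1+(t-1)\,\alpha h\,(\phi_{20}\gamma_0-\phi_{10}\gamma_1),\quad t\in[0,1].$$ The displayed formula for $\alpha$ is an implicit equation (its right-hand side depends on $\alpha$); it is understood that the denominator is nonzero. *)

theory Defs
  imports
    "HOL-Analysis.Analysis"
    "HOL-Computational_Algebra.Polynomial"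
    "Jordan_Normal_Form.Gauss_Jordan_Elimination"
    "Jordan_Normal_Form.Determinant"
begin

unbundle inner_syntax and no vec_syntax
no_notation scalar_prod (infix "\<bullet>" 70)

section \<open>Orthonormal Legendre polynomials on [0,1]\<close>

definition orthonormal_legendre :: "(nat \<Rightarrow> real poly) \<Rightarrow> bool" where
  "orthonormal_legendre P \<longleftrightarrow>
     (\<forall>j. Polynomial.degree (P j) = j \<and> lead_coeff (P j) > 0) \<and>
     (\<forall>i j. integral {0..1} (\<lambda>x. poly (P i) x * poly (P j) x) = (if i = j then 1 else 0))"

definition legendre :: "nat \<Rightarrow> real poly" where
  "legendre = (THE P. orthonormal_legendre P)"

text \<open>The description above is proper: such a family exists and is unique.\<close>

context
begin

private definition ip :: "real poly \<Rightarrow> real poly \<Rightarrow> real" where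
  "ip p q = integral {0..1} (\<lambda>x. poly p x * poly q x)"

private lemma ip_int: "(\<lambda>x. poly p x * poly q x) integrable_on {0..1::real}"
  by (rule integrable_continuous_interval, intro continuous_on_mult continuous_on_poly continuous_on_id)

private lemma ip_commute: "ip p q = ip q p"
  unfolding ip_def by (subst mult.commute) (rule refl)

private lemma ip_add: "ip (p + q) r = ip p r + ip q r"
  unfolding ip_def poly_add distrib_right by (rule integral_add[OF ip_int ip_int])

private lemma ip_diff: "ip (p - q) r = ip p r - ip q r"
  unfolding ip_def poly_diff left_diff_distrib by (rule integral_diff[OF ip_int ip_int])

private lemma ip_smult: "ip (Polynomial.smult c p) r = c * ip p r"
  unfolding ip_def poly_smult mult.assoc by (rule integral_mult_right)

private lemma ip_smult_right: "ip r (Polynomial.smult c p) = c * ip r p"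
  using ip_smult[of c p r] ip_commute[of r p] ip_commute[of r "Polynomial.smult c p"] by (simp only:)

private lemma ip_0: "ip 0 r = 0"
  by (simp add: ip_def)

private lemma ip_sum: "ip (\<Sum>i\<in>A. g i) r = (\<Sum>i\<in>A. ip (g i) r)"
  by (induction A rule: infinite_finite_induct) (simp_all add: ip_add ip_0)

private lemma ip_eq_0: "ip p p = 0 \<Longrightarrow> p = 0"
proof (rule ccontr)
  assume ip: "ip p p = 0" and p: "p \<noteq> 0"
  have "integral {0..1} (\<lambda>x. poly p x * poly p x) = 0 \<longleftrightarrow> (\<forall>x\<in>{0..1}. poly p x * poly p x = 0)"
    by (rule integral_eq_0_iff) (auto intro!: continuous_intros)
  then have "\<forall>x\<in>{0..1}. poly p x * poly p x = 0"
    using ip by (simp add: ip_def)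
  then have "{0..1} \<subseteq> {x. poly p x = 0}"
    by (simp add: subset_iff)
  then show False
    using poly_roots_finite[OF p] infinite_Icc[of "0::real" 1]
    by (simp add: rev_finite_subset)
qed

private lemma ip_pos: "p \<noteq> 0 \<Longrightarrow> ip p p > 0"
proof -
  assume "p \<noteq> 0"
  moreover have "ip p p \<ge> 0"
    unfolding ip_def by (intro integral_nonneg ip_int) auto
  ultimately show ?thesis
    using ip_eq_0[of p] by linarith
qed

private lemma span:
  assumes "\<And>i. i < n \<Longrightarrow> Polynomial.degree (P i) = i \<and> lead_coeff (P i) > (0::real)"
    and "\<And>k. k \<ge> n \<Longrightarrow> Polynomial.coeff r k = 0"
  shows "\<exists>a. r = (\<Sum>i<n. Polynomial.smult (a i) (P i))"
  using assms
proof (induction n arbitrary: r)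
  case 0
  then show ?case by (simp add: poly_eqI)
next
  case (Suc n)
  define c where "c = Polynomial.coeff r n / Polynomial.coeff (P n) n"
  have Pn: "Polynomial.degree (P n) = n" "Polynomial.coeff (P n) n > 0"
    using Suc.prems(1)[of n] by auto
  have "Polynomial.coeff (r - Polynomial.smult c (P n)) k = 0" if "k \<ge> n" for k
    using that Pn Suc.prems(2)[of k]
    by (cases "k = n") (auto simp: c_def coeff_eq_0)
  then obtain a where a: "r - Polynomial.smult c (P n) = (\<Sum>i<n. Polynomial.smult (a i) (P i))"
    using Suc.IH[of "r - Polynomial.smult c (P n)"] Suc.prems(1) by (meson less_SucI)
  have "r = (\<Sum>i<Suc n. Polynomial.smult ((a(n := c)) i) (P i))"
    using a by (simp add: algebra_simps)
  then show ?case by blast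
qed

private definition nth_leg :: "nat \<Rightarrow> real poly \<Rightarrow> bool" where
  "nth_leg n p \<longleftrightarrow> Polynomial.degree p = n \<and> lead_coeff p > 0 \<and> ip p p = 1 \<and>
     (\<forall>r. (\<forall>k\<ge>n. Polynomial.coeff r k = 0) \<longrightarrow> ip r p = 0)"

private lemma nth_leg_unique:
  assumes "nth_leg n p" "nth_leg n q"
  shows "p = q"
proof -
  define c where "c = Polynomial.coeff p n / Polynomial.coeff q n"
  define d where "d = p - Polynomial.smult c q"
  have q: "Polynomial.coeff q n > 0" "Polynomial.coeff p n > 0"
    using assms by (auto simp: nth_leg_def)
  have "\<forall>k\<ge>n. Polynomial.coeff d k = 0"
  proof (intro allI impI)
    fix k assume "n \<le> k"
    then show "Polynomial.coeff d k = 0"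
      using q assms by (cases "k = n") (auto simp: d_def c_def nth_leg_def coeff_eq_0)
  qed
  then have "ip d p = 0" "ip d q = 0"
    using assms by (auto simp: nth_leg_def)
  then have "ip d d = 0"
    using ip_diff[of p "Polynomial.smult c q" d] ip_smult[of c q d] ip_commute[of d p] ip_commute[of d q]
    unfolding d_def[symmetric] by simp
  then have pq: "p = Polynomial.smult c q"
    using ip_eq_0[of d] by (simp add: d_def)
  then have "ip p p = c * (c * ip q q)"
    by (simp add: ip_smult ip_smult_right)
  then have "c * c = 1"
    using assms by (simp add: nth_leg_def)
  moreover have "c > 0"
    using q by (simp add: c_def)
  ultimately have "c = 1"
    by (auto simp: square_eq_1_iff)
  with pq show ?thesis by simp
qed

private lemma nth_leg_exists: "\<exists>p. nth_leg n p"
proof (induction n rule: less_induct)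
  case (less n)
  then obtain P where P: "\<And>i. i < n \<Longrightarrow> nth_leg i (P i)" by metis
  have orth: "ip (P i) (P j) = (if i = j then 1 else 0)" if "i < n" "j < n" for i j
  proof -
    consider "i = j" | "i < j" | "j < i" by linarith
    then show ?thesis
    proof cases
      case 2
      then show ?thesis
        using P[OF that(1)] P[OF that(2)] unfolding nth_leg_def by (auto simp: coeff_eq_0)
    next
      case 3
      then show ?thesis
        using P[OF that(1)] P[OF that(2)] ip_commute[of "P i" "P j"]
        unfolding nth_leg_def by (auto simp: coeff_eq_0)
    qed (use P that in \<open>auto simp: nth_leg_def\<close>)
  qed
  define m :: "real poly" where "m = Polynomial.monom 1 n"
  define q where "q = m - (\<Sum>i<n. Polynomial.smult (ip m (P i)) (P i))"
  have coeff_q: "Polynomial.coeff q k = (if k = n then 1 else 0)" if "k \<ge> n" for k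
    using that P by (auto simp: q_def m_def coeff_sum nth_leg_def coeff_eq_0)
  then have "Polynomial.coeff q n = 1" by simp
  then have q0: "q \<noteq> 0" by auto
  have deg: "Polynomial.degree q = n"
    by (rule antisym, rule degree_le) (use coeff_q in \<open>auto intro: le_degree\<close>)
  have qP: "ip (P j) q = 0" if "j < n" for j
  proof -
    have "ip q (P j) = ip m (P j) - (\<Sum>i<n. ip m (P i) * ip (P i) (P j))"
      by (simp add: q_def ip_diff ip_sum ip_smult)
    also have "(\<Sum>i<n. ip m (P i) * ip (P i) (P j)) = (\<Sum>i<n. if i = j then ip m (P i) else 0)"
      using that orth by (intro sum.cong) auto
    also have "\<dots> = ip m (P j)"
      using that by simp
    finally show ?thesis by (simp add: ip_commute)
  qed
  have orth_q: "ip r q = 0" if r: "\<forall>k\<ge>n. Polynomial.coeff r k = 0" for r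
  proof -
    obtain a where "r = (\<Sum>i<n. Polynomial.smult (a i) (P i))"
      using span[of n P r] P r unfolding nth_leg_def by blast
    then show ?thesis
      using qP by (simp add: ip_sum ip_smult)
  qed
  define c where "c = 1 / sqrt (ip q q)"
  have c: "c > 0" "c * (c * ip q q) = 1"
    using ip_pos[OF q0] by (auto simp: c_def field_simps)
  have "nth_leg n (Polynomial.smult c q)"
    unfolding nth_leg_def
  proof (intro conjI allI impI)
    show "Polynomial.degree (Polynomial.smult c q) = n" "lead_coeff (Polynomial.smult c q) > 0"
      using c deg \<open>Polynomial.coeff q n = 1\<close> by auto
    show "ip (Polynomial.smult c q) (Polynomial.smult c q) = 1"
      using c by (simp add: ip_smult ip_smult_right)
    fix r :: "real poly" assume "\<forall>k\<ge>n. Polynomial.coeff r k = 0"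
    then show "ip r (Polynomial.smult c q) = 0"
      using orth_q by (simp add: ip_smult_right)
  qed
  then show ?case by blast
qed

lemma orthonormal_legendre_ex1: "\<exists>!P. orthonormal_legendre P"
proof -
  have *: "orthonormal_legendre P \<longleftrightarrow> (\<forall>n. nth_leg n (P n))" for P
  proof
    assume P: "orthonormal_legendre P"
    show "\<forall>n. nth_leg n (P n)"
    proof
      fix n
      have "ip r (P n) = 0" if r: "\<forall>k\<ge>n. Polynomial.coeff r k = 0" for r
      proof -
        obtain a where "r = (\<Sum>i<n. Polynomial.smult (a i) (P i))"
          using span[of n P r] P r unfolding orthonormal_legendre_def by blast
        moreover have "ip (P i) (P n) = 0" if "i < n" for i
          using P that by (auto simp: orthonormal_legendre_def ip_def)
        ultimately show ?thesis
          by (simp add: ip_sum ip_smult)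
      qed
      moreover have "lead_coeff (P n) > 0" "Polynomial.degree (P n) = n" "ip (P n) (P n) = 1"
        using P unfolding orthonormal_legendre_def ip_def by (blast, blast, simp)
      ultimately show "nth_leg n (P n)"
        unfolding nth_leg_def by blast
    qed
  next
    assume P: "\<forall>n. nth_leg n (P n)"
    have "ip (P i) (P j) = (if i = j then 1 else 0)" for i j
    proof -
      have lt: "ip (P i) (P j) = 0" if "i < j" for i j
        using that P unfolding nth_leg_def by (simp add: coeff_eq_0)
      show ?thesis
        using lt[of i j] lt[of j i] P by (cases i j rule: linorder_cases)
          (auto simp: ip_commute nth_leg_def)
    qed
    then show "orthonormal_legendre P"
      using P unfolding orthonormal_legendre_def nth_leg_def ip_def by blast
  qed
  obtain P where P: "\<forall>n. nth_leg n (P n)"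
    using choice[of nth_leg] nth_leg_exists by blast
  show ?thesis
  proof (rule ex1I[of _ P])
    show "orthonormal_legendre P"
      using P * by blast
    fix Q assume "orthonormal_legendre Q"
    then have "nth_leg n (Q n)" for n
      using * by blast
    then show "Q = P"
      using P by (intro ext nth_leg_unique) auto
  qed
qed

end

lemma orthonormal_legendre_legendre: "orthonormal_legendre legendre"
  unfolding legendre_def by (rule theI'[OF orthonormal_legendre_ex1])


section \<open>The Gauss-Legendre formulae and their perturbation\<close>

text \<open>
  Matrices, nodes and weights are indexed from 0: \<open>gl_node s i\<close> and \<open>gl_weight s i\<close>, for
  \<open>i < s\<close>, are the abscissa and weight usually called $c_{i+1}$ and $b_{i+1}$. The list index in
  \<open>gl_node\<close> is in range because \<open>legendre s\<close> has \<open>s\<close> distinct real zeros.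
\<close>

definition gl_node :: "nat \<Rightarrow> nat \<Rightarrow> real" where
  "gl_node s i = sorted_list_of_set {x. poly (legendre s) x = 0} ! i"

definition gl_weight :: "nat \<Rightarrow> nat \<Rightarrow> real" where
  "gl_weight s i = integral {0..1}
     (\<lambda>x. \<Prod>j\<in>{..<s} - {i}. (x - gl_node s j) / (gl_node s i - gl_node s j))"

definition P_mat :: "nat \<Rightarrow> real mat" where
  "P_mat s = Matrix.mat s s (\<lambda>(i,j). poly (legendre j) (gl_node s i))"

definition Omega_mat :: "nat \<Rightarrow> real mat" where
  "Omega_mat s = mat_diag s (gl_weight s)"

definition xi :: "nat \<Rightarrow> real" where
  "xi i = 1 / (2 * sqrt \<bar>4 * (real i)\<^sup>2 - 1\<bar>)"

definition X_mat :: "nat \<Rightarrow> real mat" where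
  "X_mat s = Matrix.mat s s (\<lambda>(i,j).
     if i = 0 \<and> j = 0 then xi 0
     else if i = j + 1 then xi i
     else if j = i + 1 then - xi j
     else 0)"

definition outer_prod :: "real vec \<Rightarrow> real vec \<Rightarrow> real mat" where
  "outer_prod u v = Matrix.mat (dim_vec u) (dim_vec v) (\<lambda>(i,j). u $ i * v $ j)"

definition W_mat :: "nat \<Rightarrow> real mat" where
  "W_mat s = outer_prod (unit_vec s 1) (unit_vec s 0) - outer_prod (unit_vec s 0) (unit_vec s 1)"

definition X_pert :: "nat \<Rightarrow> real \<Rightarrow> real mat" where
  "X_pert s \<alpha> = X_mat s - \<alpha> \<cdot>\<^sub>m W_mat s"

definition butcher_mat :: "nat \<Rightarrow> real \<Rightarrow> real mat" where
  "butcher_mat s \<alpha> = P_mat s * X_pert s \<alpha> * transpose_mat (P_mat s) * Omega_mat s"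

text \<open>
  In \<open>phi s i j\<close> the index \<open>i\<close> is 1 or 2 and counts from 1, whereas \<open>j < s\<close> counts from 0.
\<close>

definition phi :: "nat \<Rightarrow> nat \<Rightarrow> nat \<Rightarrow> real" where
  "phi s i j = (the (mat_inverse (X_mat s)) *\<^sub>v unit_vec s (i - 1)) $ j"

lemma mat_inverse_X_mat:
  obtains B where "mat_inverse (X_mat s) = Some B"
    "X_mat s * B = 1\<^sub>m s" "B * X_mat s = 1\<^sub>m s" "B \<in> carrier_mat s s"
proof -
  have X: "X_mat s \<in> carrier_mat s s"
    by (simp add: X_mat_def)
  have xi: "xi i \<noteq> 0" for i
  proof -
    have "4 * (int i)\<^sup>2 - 1 \<noteq> 0" by presburger
    then have "real_of_int (4 * (int i)\<^sup>2 - 1) \<noteq> 0"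
      by (simp only: of_int_eq_0_iff not_False_eq_True)
    then show ?thesis
      by (simp add: xi_def)
  qed
  have "v = 0\<^sub>v s" if v: "v \<in> carrier_vec s" and Xv: "X_mat s *\<^sub>v v = 0\<^sub>v s" for v
  proof -
    define w where "w i = (if i < s then v $ i else 0)" for i
    have w_out: "w i = 0" if "\<not> i < s" for i
      using that by (simp add: w_def)
    have row: "(\<Sum>j<s. X_mat s $$ (i,j) * w j) = 0" if "i < s" for i
    proof -
      have "(X_mat s *\<^sub>v v) $ i = (\<Sum>j<s. X_mat s $$ (i,j) * w j)"
        using that v X by (auto simp: scalar_prod_def w_def atLeast0LessThan intro!: sum.cong)
      then show ?thesis using Xv that by simp
    qed
    have row0: "xi 0 * w 0 = xi 1 * w 1" if "0 < s"
    proof -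
      have "0 = (\<Sum>j<s. X_mat s $$ (0,j) * w j)" using row[OF that] by simp
      also have "\<dots> = (\<Sum>j<s. (if j = 0 then xi 0 * w j else 0) + (if j = 1 then - xi 1 * w j else 0))"
        using that by (intro sum.cong) (auto simp: X_mat_def)
      also have "\<dots> = xi 0 * w 0 - xi 1 * w 1"
        using that by (simp add: sum.distrib w_def)
      finally show ?thesis by simp
    qed
    have rowS: "xi (Suc i) * w i = xi (Suc (Suc i)) * w (Suc (Suc i))" if "Suc i < s" for i
    proof -
      have "0 = (\<Sum>j<s. X_mat s $$ (Suc i,j) * w j)" using row[OF that] by simp
      also have "\<dots> = (\<Sum>j<s. (if j = i then xi (Suc i) * w j else 0)
          + (if j = Suc (Suc i) then - xi (Suc (Suc i)) * w j else 0))"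
        using that by (intro sum.cong) (auto simp: X_mat_def)
      also have "\<dots> = xi (Suc i) * w i - xi (Suc (Suc i)) * w (Suc (Suc i))"
        using that by (simp add: sum.distrib w_def)
      finally show ?thesis by simp
    qed
    \<comment> \<open>Telescoping: \<open>xi (i+1) * w i * w (i+1)\<close> is constant in \<open>i\<close> and vanishes at the last row.\<close>
    have const: "xi (Suc i) * w i * w (Suc i) = xi 1 * w 0 * w 1" if "i \<le> s" for i
      using that
    proof (induction i)
      case (Suc i)
      show ?case
      proof (cases "Suc i < s")
        case True
        have "xi (Suc (Suc i)) * w (Suc i) * w (Suc (Suc i))
            = (xi (Suc (Suc i)) * w (Suc (Suc i))) * w (Suc i)"
          by simp
        also have "\<dots> = xi (Suc i) * w i * w (Suc i)"
          by (simp only: rowS[OF True])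
        finally show ?thesis
          using Suc by simp
      next
        case False
        then have "w (Suc i) = 0"
          by (simp add: w_out)
        then show ?thesis
          using Suc by simp
      qed
    qed simp
    have "xi 1 * w 0 * w 1 = 0"
      using const[of s] by (simp add: w_out)
    then have w0: "w 0 = 0"
      using row0 xi[of 0] xi[of 1] w_out[of 0] by (cases "0 < s") auto
    then have w1: "w 1 = 0"
      using row0 xi[of 1] w_out[of 1] by (cases "0 < s") auto
    have "w i = 0 \<and> w (Suc i) = 0" for i
    proof (induction i)
      case (Suc i)
      then show ?case
        using rowS[of i] xi[of "Suc (Suc i)"] w_out[of "Suc (Suc i)"]
        by (cases "Suc i < s") auto
    qed (use w0 w1 in simp)
    then have "v $ i = 0" if "i < s" for i
      using that unfolding w_def by metis
    then show ?thesis
      using v by (intro eq_vecI) simp_all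
  qed
  then have "Determinant.det (X_mat s) \<noteq> 0"
    using det_0_iff_vec_prod_zero_field[OF X] by blast
  then have "X_mat s \<in> Units (ring_mat TYPE(real) s ())"
    by (rule det_non_zero_imp_unit[OF X])
  then obtain B where "mat_inverse (X_mat s) = Some B"
    using mat_inverse(1)[OF X, of "()"] by (cases "mat_inverse (X_mat s)") auto
  with mat_inverse(2)[OF X this] show ?thesis
    using that by blast
qed

end

theory Submission
  imports Defs
begin

text \<open>
  The piecewise smooth path that follows \<open>\<sigma>1\<close> from \<open>y0\<close> and then \<open>\<sigma>2\<close> ends at \<open>y1\<close>: the two pieces
  match because \<open>legendre 0 = 1\<close> makes every integral of \<open>legendre j\<close> over [0,1] with \<open>j > 0\<close> vanish.
  By the fundamental theorem of calculus, \<open>C y1 - C y0\<close> is the line integral of the gradient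
  along this path, which is affine in \<open>\<alpha>\<close>; the prescribed \<open>\<alpha>\<close> is its zero.
\<close>

text \<open>A constant whose square integrates to 1 is 1 or -1, and the sign convention on the
  leading coefficient leaves 1.\<close>

lemma legendre_0: "legendre 0 = 1"
proof -
  have deg: "Polynomial.degree (legendre 0) = 0" and lead: "lead_coeff (legendre 0) > 0"
    and norm: "integral {0..1} (\<lambda>x. poly (legendre 0) x * poly (legendre 0) x) = 1"
    using orthonormal_legendre_legendre unfolding orthonormal_legendre_def by (blast, blast, simp)
  obtain a where a: "legendre 0 = [:a:]"
    using deg by (auto elim: degree_eq_zeroE)
  then have "a * a = 1" "a > 0"
    using norm lead by auto
  then have "a = 1"
    by (auto simp: square_eq_1_iff)
  then show ?thesis
    by (simp add: a one_pCons)
qed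

text \<open>This is orthonormality against \<open>legendre 0\<close>, which is the constant
  1.\<close>

lemma integral_legendre:
  "integral {0..1} (poly (legendre j)) = (if j = 0 then 1 else 0)"
proof -
  have "integral {0..1} (\<lambda>x. poly (legendre j) x * poly (legendre 0) x) = (if j = 0 then 1 else 0)"
    using orthonormal_legendre_legendre unfolding orthonormal_legendre_def by blast
  then show ?thesis
    by (simp add: legendre_0)
qed

text \<open>By the chain rule the integrand is the derivative of \<open>C \<circ> p\<close>, so the
  fundamental theorem of calculus applies. Derivatives are taken within the interval because the
  path built from \<open>integral {0..c}\<close> is constant for negative c and need not be
  differentiable at 0 from both sides.\<close>

lemma line_integral_gradient:
  fixes C :: "'a::real_inner \<Rightarrow> real"
  assumes "a \<le> b"
    and C: "\<And>y. y \<in> U \<Longrightarrow> GDERIV C y :> gradC y"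
    and p: "\<And>c. c \<in> {a..b} \<Longrightarrow> (p has_vector_derivative p' c) (at c within {a..b})"
    and U: "\<And>c. c \<in> {a..b} \<Longrightarrow> p c \<in> U"
  shows "((\<lambda>c. gradC (p c) \<bullet> p' c) has_integral C (p b) - C (p a)) {a..b}"
proof -
  have "((C \<circ> p) has_vector_derivative gradC (p c) \<bullet> p' c) (at c within {a..b})"
    if c: "c \<in> {a..b}" for c
  proof -
    have "(C has_derivative (\<lambda>v. v \<bullet> gradC (p c))) (at (p c) within p ` {a..b})"
      using C[OF U[OF c]] unfolding gderiv_def by (rule has_derivative_at_withinI)
    from vector_derivative_diff_chain_within[OF p[OF c] this]
    show ?thesis by (simp add: inner_commute)
  qed
  from fundamental_theorem_of_calculus[OF \<open>a \<le> b\<close> this] show ?thesis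
    by simp
qed

theorem theorem2:
  fixes U :: "(real ^ 'm) set"
    and f gradC :: "real ^ 'm \<Rightarrow> real ^ 'm"
    and C :: "real ^ 'm \<Rightarrow> real"
    and s :: nat and h \<alpha> :: real
    and y0 y1 :: "real ^ 'm"
    and Y \<gamma> \<rho> :: "nat \<Rightarrow> real ^ 'm"
    and \<sigma>1 \<sigma>2 :: "real \<Rightarrow> real ^ 'm"
    and \<rho>bar :: "real ^ 'm"
  assumes "open U" and "y0 \<in> U"
    and "continuous_on U f"
    and "\<And>y. y \<in> U \<Longrightarrow> GDERIV C y :> gradC y" and "continuous_on U gradC"
    and "\<And>y. y \<in> U \<Longrightarrow> gradC y \<bullet> f y = 0"
    and "s \<ge> 2" and "h > 0"
    and "\<And>i. i < s \<Longrightarrow> Y i \<in> U"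
    and "\<And>i. i < s \<Longrightarrow> Y i = y0 + h *\<^sub>R (\<Sum>j<s. butcher_mat s \<alpha> $$ (i,j) *\<^sub>R f (Y j))"
    and "y1 = y0 + h *\<^sub>R (\<Sum>i<s. gl_weight s i *\<^sub>R f (Y i))"
    and "\<And>j. j < s \<Longrightarrow>
      \<gamma> j = (\<Sum>i<s. (gl_weight s i * poly (legendre j) (gl_node s i)) *\<^sub>R f (Y i))"
    and "\<And>c. c \<in> {0..1} \<Longrightarrow>
      \<sigma>1 (c * h) = y0 + h *\<^sub>R (\<Sum>j<s. integral {0..c} (poly (legendre j)) *\<^sub>R
        (\<gamma> j - \<alpha> *\<^sub>R (phi s 2 j *\<^sub>R \<gamma> 0 - phi s 1 j *\<^sub>R \<gamma> 1)))"
    and "\<And>t. t \<in> {0..1} \<Longrightarrow>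
      \<sigma>2 t = y1 + ((t - 1) * \<alpha> * h) *\<^sub>R (phi s 2 0 *\<^sub>R \<gamma> 0 - phi s 1 0 *\<^sub>R \<gamma> 1)"
    and "\<And>c. c \<in> {0..1} \<Longrightarrow> \<sigma>1 (c * h) \<in> U"
    and "\<And>t. t \<in> {0..1} \<Longrightarrow> \<sigma>2 t \<in> U"
    and "\<And>j. j < s \<Longrightarrow>
      \<rho> j = integral {0..1} (\<lambda>c. poly (legendre j) c *\<^sub>R gradC (\<sigma>1 (c * h)))"
    and "\<rho>bar = integral {0..1} (\<lambda>c. gradC (\<sigma>2 c))"
    and "(\<rho> 0 - \<rho>bar) \<bullet> (phi s 2 0 *\<^sub>R \<gamma> 0 - phi s 1 0 *\<^sub>R \<gamma> 1)
      + (\<Sum>j=1..s-1. \<rho> j \<bullet> (phi s 2 j *\<^sub>R \<gamma> 0 - phi s 1 j *\<^sub>R \<gamma> 1)) \<noteq> 0"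
    and "\<alpha> = (\<Sum>j<s. \<rho> j \<bullet> \<gamma> j) /
      ((\<rho> 0 - \<rho>bar) \<bullet> (phi s 2 0 *\<^sub>R \<gamma> 0 - phi s 1 0 *\<^sub>R \<gamma> 1)
        + (\<Sum>j=1..s-1. \<rho> j \<bullet> (phi s 2 j *\<^sub>R \<gamma> 0 - phi s 1 j *\<^sub>R \<gamma> 1)))"
  shows "C y1 = C y0"
proof -
  note dC = assms(4) and contC = assms(5) and s2 = assms(7)
    and y1 = assms(11) and \<gamma> = assms(12) and \<sigma>1 = assms(13) and \<sigma>2 = assms(14)
    and U1 = assms(15) and U2 = assms(16) and \<rho> = assms(17) and \<rho>bar = assms(18)
  \<comment> \<open>\<open>d j\<close> is the direction that \<alpha> scales, and \<open>v j\<close>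
    is the corrected coefficient of \<open>legendre j\<close>. Since \<sigma>1 and \<sigma>2 are
    prescribed only for parameters in [0,1], \<open>p\<close> and \<open>q\<close> extend their
    formulas to all reals, with \<open>p\<close> in the rescaled time c.\<close>
  define d where "d j = phi s 2 j *\<^sub>R \<gamma> 0 - phi s 1 j *\<^sub>R \<gamma> 1" for j
  define v where "v j = \<gamma> j - \<alpha> *\<^sub>R d j" for j
  define p where "p c = y0 + h *\<^sub>R (\<Sum>j<s. integral {0..c} (poly (legendre j)) *\<^sub>R v j)" for c
  define q where "q t = y1 + ((t - 1) * \<alpha> * h) *\<^sub>R d 0" for t
  have p: "\<sigma>1 (c * h) = p c" if "c \<in> {0..1}" for c
    using \<sigma>1[OF that] by (simp add: p_def v_def d_def)
  have q: "\<sigma>2 t = q t" if "t \<in> {0..1}" for t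
    using \<sigma>2[OF that] by (simp add: q_def d_def)
  have pU: "p c \<in> U" if "c \<in> {0..1}" for c
    using U1[OF that] p[OF that] by simp
  have qU: "q t \<in> U" if "t \<in> {0..1}" for t
    using U2[OF that] q[OF that] by simp

  have dp: "(p has_vector_derivative h *\<^sub>R (\<Sum>j<s. poly (legendre j) c *\<^sub>R v j)) (at c within {0..1})"
    if "c \<in> {0..1}" for c
  proof -
    have "((\<lambda>c. integral {0..c} (poly (legendre j)) *\<^sub>R v j) has_vector_derivative
        poly (legendre j) c *\<^sub>R v j) (at c within {0..1})" for j
      by (intro bounded_linear.has_vector_derivative[OF bounded_linear_scaleR_left]
          integral_has_vector_derivative that continuous_intros)
    then have "((\<lambda>c. h *\<^sub>R (\<Sum>j<s. integral {0..c} (poly (legendre j)) *\<^sub>R v j)) has_vector_derivative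
        h *\<^sub>R (\<Sum>j<s. poly (legendre j) c *\<^sub>R v j)) (at c within {0..1})"
      by (intro bounded_linear.has_vector_derivative[OF bounded_linear_scaleR_right]
          has_vector_derivative_sum)
    from has_vector_derivative_add[OF has_vector_derivative_const this] show ?thesis
      unfolding p_def by simp
  qed
  have dq: "(q has_vector_derivative (\<alpha> * h) *\<^sub>R d 0) (at t within {0..1})" for t
    unfolding q_def by (auto intro!: derivative_eq_intros)

  \<comment> \<open>Stated for an arbitrary differentiable path in U, so that it serves both
    \<open>p\<close> and \<open>q\<close>. It makes the integrands of \<open>\<rho> j\<close> and
    \<open>\<rho>bar\<close> integrable; otherwise \<open>integral\<close> could be a default
    value.\<close>
  have cont: "continuous_on {0..1} (\<lambda>c. gradC (r c))"
    if "\<And>c. c \<in> {0..1} \<Longrightarrow> (r has_vector_derivative r' c) (at c within {0..1})"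
      and "\<And>c. c \<in> {0..1::real} \<Longrightarrow> r c \<in> U" for r r'
    by (rule continuous_on_compose2[OF contC continuous_on_vector_derivative[OF that(1)]])
      (use that(2) in auto)

  have "((\<lambda>c. (poly (legendre j) c *\<^sub>R gradC (p c)) \<bullet> v j) has_integral \<rho> j \<bullet> v j) {0..1}"
    if "j < s" for j
  proof -
    have "\<rho> j = integral {0..1} (\<lambda>c. poly (legendre j) c *\<^sub>R gradC (p c))"
      unfolding \<rho>[OF that] by (rule integral_cong) (simp add: p)
    moreover have "(\<lambda>c. poly (legendre j) c *\<^sub>R gradC (p c)) integrable_on {0..1}"
      by (intro integrable_continuous_interval continuous_on_scaleR cont[OF dp pU]
          continuous_intros)
    ultimately have "((\<lambda>c. poly (legendre j) c *\<^sub>R gradC (p c)) has_integral \<rho> j) {0..1}"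
      by (simp add: has_integral_integral[symmetric])
    from has_integral_linear[OF this bounded_linear_inner_left, unfolded o_def]
    show ?thesis .
  qed
  then have "((\<lambda>c. h * (\<Sum>j<s. (poly (legendre j) c *\<^sub>R gradC (p c)) \<bullet> v j)) has_integral
      h * (\<Sum>j<s. \<rho> j \<bullet> v j)) {0..1}"
    by (intro has_integral_mult_right has_integral_sum) auto
  then have "((\<lambda>c. gradC (p c) \<bullet> h *\<^sub>R (\<Sum>j<s. poly (legendre j) c *\<^sub>R v j)) has_integral
      h * (\<Sum>j<s. \<rho> j \<bullet> v j)) {0..1}"
    by (simp add: inner_sum_right)
  \<comment> \<open>The same integrand has been integrated twice: as the derivative of
    \<open>C\<close> along \<open>p\<close>, and term by term through the moments
    \<open>\<rho> j\<close>.\<close>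
  from has_integral_unique[OF line_integral_gradient[OF _ dC dp pU] this]
  have C1: "C (p 1) - C (p 0) = h * (\<Sum>j<s. \<rho> j \<bullet> v j)"
    by simp

  have "\<rho>bar = integral {0..1} (\<lambda>c. gradC (q c))"
    unfolding \<rho>bar by (rule integral_cong) (simp add: q)
  then have "((\<lambda>c. gradC (q c)) has_integral \<rho>bar) {0..1}"
    using integrable_continuous_interval[OF cont[OF dq qU]]
    by (simp add: has_integral_integral[symmetric])
  from has_integral_linear[OF this bounded_linear_inner_left, unfolded o_def]
  have "((\<lambda>c. gradC (q c) \<bullet> (\<alpha> * h) *\<^sub>R d 0) has_integral \<rho>bar \<bullet> (\<alpha> * h) *\<^sub>R d 0) {0..1}" .
  \<comment> \<open>The velocity of \<open>q\<close> is constant, so only the mean gradient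
    \<open>\<rho>bar\<close> enters.\<close>
  from has_integral_unique[OF line_integral_gradient[OF _ dC dq qU] this]
  have C2: "C (q 1) - C (q 0) = h * \<alpha> * (\<rho>bar \<bullet> d 0)"
    by simp

  have split: "(\<Sum>j<s. g j) = g 0 + (\<Sum>j=1..s-1. g j)" for g :: "nat \<Rightarrow> real"
  proof -
    have "{..<s} = insert 0 {1..s-1}" using s2 by auto
    then show ?thesis by simp
  qed
  have "(\<Sum>j<s. integral {0..1} (poly (legendre j)) *\<^sub>R v j) = (\<Sum>j<s. if j = 0 then v j else 0)"
    by (intro sum.cong) (auto simp: integral_legendre)
  also have "\<dots> = v 0"
    using s2 by simp
  finally have "p 1 = y0 + h *\<^sub>R v 0"
    by (simp add: p_def)
  moreover have "y1 = y0 + h *\<^sub>R \<gamma> 0"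
    using \<gamma>[of 0] s2 by (simp add: y1 legendre_0)
  \<comment> \<open>Both points equal
    \<open>y0 + h *\<^sub>R (\<gamma> 0 - \<alpha> *\<^sub>R d 0)\<close>: starting \<open>q\<close>
    at t = 0 subtracts from \<open>y1\<close> exactly the correction that the mode j = 0 puts into
    \<open>p 1\<close>.\<close>
  ultimately have pq: "p 1 = q 0"
    by (simp add: q_def v_def algebra_simps)
  have ends: "p 0 = y0" "q 1 = y1"
    by (simp_all add: p_def q_def)

  have "C y1 - C y0 = h * ((\<Sum>j<s. \<rho> j \<bullet> v j) + \<alpha> * (\<rho>bar \<bullet> d 0))"
    using C1 C2 pq ends by (simp add: algebra_simps)
  also have "(\<Sum>j<s. \<rho> j \<bullet> v j) = (\<Sum>j<s. \<rho> j \<bullet> \<gamma> j) - \<alpha> * (\<Sum>j<s. \<rho> j \<bullet> d j)"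
    by (simp add: v_def inner_diff_right sum_subtractf sum_distrib_left)
  \<comment> \<open>The term j = 0 is isolated because the contribution of \<open>q\<close> also
    lies along \<open>d 0\<close>; together they give the factor \<open>\<rho> 0 - \<rho>bar\<close>
    of the denominator.\<close>
  also have "(\<Sum>j<s. \<rho> j \<bullet> d j) = \<rho> 0 \<bullet> d 0 + (\<Sum>j=1..s-1. \<rho> j \<bullet> d j)"
    by (rule split)
  \<comment> \<open>The nonzero denominator allows the implicit equation for \<alpha> to be cleared;
    after this substitution all terms cancel.\<close>
  also have "(\<Sum>j<s. \<rho> j \<bullet> \<gamma> j) = \<alpha> * ((\<rho> 0 - \<rho>bar) \<bullet> d 0 + (\<Sum>j=1..s-1. \<rho> j \<bullet> d j))"
    using assms(19,20) unfolding d_def by (simp add: eq_divide_eq)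
  finally show ?thesis
    by (simp add: inner_diff_left algebra_simps)
qed

end
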